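(* Let $k\ge 2$ be an integer. Every tournament $T$ with $\delta^+(T)\ge 2k^2+147k^{7/4}$ contains a subdivision of $\overrightarrow{K}_k$ in which each edge is subdivided at most twice (i.e. each path of the subdivision has length at most $3$).
   Context: A tournament is a directed graph in which every pair of distinct vertices is joined by exactly one directed edge; $\delta^+(T)$ is its minimum out-degree. $\overrightarrow{K}_k$ is the complete directed graph on $k$ vertices. A subdivision of $\overrightarrow{K}_k$ in $T$ consists of a set $B$ of $k$ vertices and, for every ordered pair $(x,y)$ of distinct vertices of $B$, a directed path from $x$ to $y$, the $2\binom{k}{2}$ paths being pairwise internally vertex-disjoint with internal vertices outside $B$. The length of a path is its number of edges. *)

theory Defs
  imports "HOL-Analysis.Analysis" "Graph_Theory.Graph_Theory"
begin

text \<open>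
  The locale \<^locale>\<open>digraph\<close> describes finite directed graphs without loops and without
  parallel arcs.
\<close>

locale tournament = digraph +
  assumes ex1_arc_between: "\<lbrakk>u \<in> verts G; v \<in> verts G; u \<noteq> v\<rbrakk> \<Longrightarrow>
    \<exists>!e. e \<in> arcs G \<and> (arc_to_ends G e = (u, v) \<or> arc_to_ends G e = (v, u))"

text \<open>Only meaningful for finite digraphs with at least one vertex.\<close>

definition min_out_degree :: "('a, 'b) pre_digraph \<Rightarrow> nat" where
  "min_out_degree G = Min (out_degree G ` verts G)"

text \<open>
  \<open>B\<close> is the set of branch vertices and \<open>P x y\<close> is the path (a list of arcs) that replaces the
  arc from \<open>x\<close> to \<open>y\<close> of the complete digraph on \<open>B\<close>; the paths for \<open>(x, y)\<close> and \<open>(y, x)\<close> are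
  different ones. The values of \<open>P\<close> outside pairs of distinct elements of \<open>B\<close> are irrelevant.
  The notion \<^const>\<open>subdivision\<close> of the library is not applicable, since it always subdivides an
  arc together with its reverse, by a common new vertex.
\<close>

definition (in pre_digraph) complete_subdivision ::
    "'a set \<Rightarrow> ('a \<Rightarrow> 'a \<Rightarrow> 'b awalk) \<Rightarrow> bool" where
  "complete_subdivision B P \<longleftrightarrow>
     B \<subseteq> verts G \<and>
     (\<forall>x\<in>B. \<forall>y\<in>B. x \<noteq> y \<longrightarrow>
        apath x (P x y) y \<and> set (inner_verts (P x y)) \<inter> B = {}) \<and>
     (\<forall>x\<in>B. \<forall>y\<in>B. \<forall>x'\<in>B. \<forall>y'\<in>B. x \<noteq> y \<longrightarrow> x' \<noteq> y' \<longrightarrow> (x, y) \<noteq> (x', y') \<longrightarrow>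
        set (inner_verts (P x y)) \<inter> set (inner_verts (P x' y')) = {})"

end

theory Submission
  imports Defs
begin

text \<open>
  Pass to a subtournament that maximises the minimum out-degree \<open>d\<close>. More than \<open>k\<close> of its vertices
  then have out-degree at most \<open>d + k\<close>; any \<open>k\<close> of these serve as branch vertices. Of each pair of
  branch vertices one direction is an arc already, so at most \<open>k (k - 1) / 2\<close> paths need inner
  vertices. For such a pair \<open>(x, y)\<close> let \<open>p\<close> be the number of paths of length 2 from \<open>x\<close> to \<open>y\<close>.
  Suppose that the set \<open>W\<close> meets all paths of length at most 3 from \<open>x\<close> to \<open>y\<close>, and let \<open>a\<close> have
  the least out-degree within the out-neighbours of \<open>x\<close> outside \<open>W\<close>. The out-neighbours of \<open>a\<close>
  lie among those of \<open>x\<close>, in \<open>W\<close>, or among the about \<open>p\<close> vertices that dominate \<open>x\<close> and are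
  dominated by \<open>y\<close>. Counting them gives \<open>2 |W| \<ge> d - p - O(k)\<close>.

  First join as many pairs as possible, say \<open>t\<close>, by disjoint paths of length 2. By maximality the
  other pairs have \<open>p \<le> t + k\<close>. Joining these greedily, at most \<open>k + t + 2 (k (k - 1) / 2 - t - 1)\<close>
  vertices have to be avoided at any time, and the loss of \<open>t\<close> in \<open>d - p\<close> is made up for by the
  inner vertices saved. It suffices that \<open>d \<ge> 2 k\<^sup>2 + 4 k\<close>.
\<close>

section \<open>Greedy choice of disjoint sets\<close>

text \<open>The indices are served one at a time: at most \<open>card K - 1\<close> sets of size at
  most \<open>c\<close> precede the current one, so together with \<open>W\<close> they form an
  obstacle \<open>X\<close> of size at most \<open>m\<close>, which \<open>step\<close> can
  avoid.\<close>

lemma greedy_disjoint_family: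
  assumes "finite K" "finite W" "card W + c * (card K - 1) \<le> m"
    and fin: "\<And>p. finite (g p)"
    and step: "\<And>i X. i \<in> K \<Longrightarrow> finite X \<Longrightarrow> W \<subseteq> X \<Longrightarrow> card X \<le> m \<Longrightarrow>
      \<exists>p. R i p \<and> g p \<inter> X = {} \<and> card (g p) \<le> c"
  shows "\<exists>Q. (\<forall>i\<in>K. R i (Q i) \<and> g (Q i) \<inter> W = {}) \<and> disjoint_family_on (\<lambda>i. g (Q i)) K"
proof -
  have "\<exists>Q. (\<forall>i\<in>L. R i (Q i) \<and> g (Q i) \<inter> W = {}) \<and> disjoint_family_on (\<lambda>i. g (Q i)) L \<and>
      card (\<Union>i\<in>L. g (Q i)) \<le> c * card L" if "L \<subseteq> K" for L
    using finite_subset[OF that \<open>finite K\<close>] that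
  proof (induction L rule: finite_induct)
    case empty
    then show ?case by (simp add: disjoint_family_on_def)
  next
    case (insert j L)
    then obtain Q where Q: "\<forall>i\<in>L. R i (Q i) \<and> g (Q i) \<inter> W = {}"
        "disjoint_family_on (\<lambda>i. g (Q i)) L" "card (\<Union>i\<in>L. g (Q i)) \<le> c * card L"
      by auto
    let ?X = "W \<union> (\<Union>i\<in>L. g (Q i))"
    have "card L < card K"
      using insert \<open>finite K\<close> by (intro psubset_card_mono) auto
    then have "c * card L \<le> c * (card K - 1)"
      by (intro mult_le_mono2) linarith
    then have "card ?X \<le> m"
      using card_Un_le[of W "\<Union>i\<in>L. g (Q i)"] Q(3) assms(3) by linarith
    moreover have "finite ?X"
      using insert \<open>finite W\<close> fin by auto
    ultimately obtain p where p: "R j p" "g p \<inter> ?X = {}" "card (g p) \<le> c"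
      using step[of j ?X] insert.prems by auto
    let ?Q = "Q(j := p)"
    have same: "?Q i = Q i" if "i \<in> L" for i
      using that insert.hyps by auto
    have "(\<Union>i\<in>insert j L. g (?Q i)) = g p \<union> (\<Union>i\<in>L. g (Q i))"
      using same by auto
    then have "card (\<Union>i\<in>insert j L. g (?Q i)) \<le> c * card (insert j L)"
      using card_Un_le[of "g p" "\<Union>i\<in>L. g (Q i)"] p(3) Q(3) insert.hyps by simp
    moreover have "disjoint_family_on (\<lambda>i. g (?Q i)) (insert j L)"
      using Q(2) p(2) insert.hyps by (auto simp: disjoint_family_on_def)
    moreover have "\<forall>i\<in>insert j L. R i (?Q i) \<and> g (?Q i) \<inter> W = {}"
      using Q(1) p insert.hyps by auto
    ultimately show ?case by blast
  qed
  from this[of K] show ?thesis by auto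
qed

section \<open>Short paths from lists of vertices\<close>

lemma (in wf_digraph) awalk_of_verts:
  assumes "u \<in> verts G" "successively (\<lambda>u v. u \<rightarrow>\<^bsub>G\<^esub> v) (u # us)"
  shows "\<exists>p. awalk u p (last (u # us)) \<and> awalk_verts u p = u # us"
  using assms
proof (induction us arbitrary: u)
  case Nil
  then show ?case by (intro exI[of _ "[]"]) (simp add: awalk_Nil_iff)
next
  case (Cons w us)
  then obtain e where e: "e \<in> arcs G" "tail G e = u" "head G e = w" by auto
  moreover obtain p where "awalk w p (last (w # us))" "awalk_verts w p = w # us"
    using Cons.IH[of w] Cons.prems e by auto
  ultimately show ?case
    by (intro exI[of _ "e # p"]) (auto simp: awalk_Cons_iff)
qed

definition (in pre_digraph) short_path :: "'a \<Rightarrow> 'b awalk \<Rightarrow> 'a \<Rightarrow> bool" where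
  "short_path x p y \<longleftrightarrow> apath x p y \<and> length p \<le> 3"

lemma (in pre_digraph) card_inner_verts_short_path:
  "short_path x p y \<Longrightarrow> card (set (inner_verts p)) \<le> 2"
  using card_length[of "inner_verts p"] by (auto simp: short_path_def inner_verts_def)

lemma (in wf_digraph) short_path_of_verts:
  assumes "successively (\<lambda>u v. u \<rightarrow>\<^bsub>G\<^esub> v) (x # us @ [y])" "distinct (x # us @ [y])" "length us \<le> 2"
  shows "\<exists>p. short_path x p y \<and> inner_verts p = us"
proof -
  have "x \<in> verts G"
    using assms(1) adj_in_verts by (cases us) auto
  then obtain p where p: "awalk x p y" "awalk_verts x p = x # us @ [y]"
    using awalk_of_verts[OF _ assms(1)] by auto
  then have "length p = length us + 1"
    using length_awalk_verts[of x p] by simp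
  then show ?thesis
    using p assms by (auto simp: short_path_def apath_def inner_verts_conv[of _ x])
qed

section \<open>Out-degrees in subtournaments\<close>

context tournament
begin

text \<open>A subtournament is represented by its vertex set \<open>U\<close>, so that its paths are
  paths of \<open>G\<close> without any transfer.\<close>

definition out_nbs :: "'a set \<Rightarrow> 'a \<Rightarrow> 'a set" where
  "out_nbs U v = {w \<in> U. v \<rightarrow>\<^bsub>G\<^esub> w}"

definition midpoints :: "'a set \<Rightarrow> 'a \<Rightarrow> 'a \<Rightarrow> 'a set" where
  "midpoints U x y = {v \<in> U. x \<rightarrow>\<^bsub>G\<^esub> v \<and> v \<rightarrow>\<^bsub>G\<^esub> y}"

lemma finite_out_nbs [simp]: "finite U \<Longrightarrow> finite (out_nbs U v)"
  and finite_midpoints [simp]: "finite U \<Longrightarrow> finite (midpoints U x y)"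
  by (simp_all add: out_nbs_def midpoints_def)

lemma dominates_total:
  assumes "u \<in> verts G" "v \<in> verts G" "u \<noteq> v"
  shows "u \<rightarrow>\<^bsub>G\<^esub> v \<or> v \<rightarrow>\<^bsub>G\<^esub> u"
  using ex1_arc_between[OF assms] dominatesI by blast

lemma dominates_asym:
  assumes "u \<rightarrow>\<^bsub>G\<^esub> v"
  shows "\<not> v \<rightarrow>\<^bsub>G\<^esub> u"
proof
  assume "v \<rightarrow>\<^bsub>G\<^esub> u"
  have uv: "u \<in> verts G" "v \<in> verts G" "u \<noteq> v"
    using assms adj_in_verts adj_not_same by blast+
  obtain e where e: "e \<in> arcs G" "arc_to_ends G e = (u, v)"
    using assms by (auto simp: arcs_ends_def)
  obtain e' where e': "e' \<in> arcs G" "arc_to_ends G e' = (v, u)"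
    using \<open>v \<rightarrow>\<^bsub>G\<^esub> u\<close> by (auto simp: arcs_ends_def)
  have "e = e'"
    using ex1_arc_between[OF uv] e e' by blast
  then show False
    using e e' uv by simp
qed

lemma card_out_nbs_verts: "card (out_nbs (verts G) v) = out_degree G v"
proof -
  have "bij_betw (head G) (out_arcs G v) (out_nbs (verts G) v)"
    unfolding bij_betw_def
  proof
    show "inj_on (head G) (out_arcs G v)"
      by (auto intro!: inj_onI no_multi_arcs simp: arc_to_ends_def)
    show "head G ` out_arcs G v = out_nbs (verts G) v"
      by (force simp: out_nbs_def arcs_ends_conv)
  qed
  then show ?thesis
    by (simp add: out_degree_def bij_betw_same_card)
qed

text \<open>Averaging: the out-degrees inside \<open>U\<close> add up to the number of arcs inside
  \<open>U\<close>, which is half of \<open>card U * (card U - 1)\<close>.\<close>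

lemma exists_low_score_vertex:
  assumes "U \<subseteq> verts G" "U \<noteq> {}"
  shows "\<exists>a\<in>U. 2 * card (out_nbs U a) < card U"
proof (rule ccontr)
  assume neg: "\<not> ?thesis"
  have fin: "finite U"
    using finite_subset[OF assms(1)] by simp
  have out: "card (out_nbs U a) = (\<Sum>w\<in>U. of_bool (a \<rightarrow>\<^bsub>G\<^esub> w))" for a
    using fin by (simp add: out_nbs_def of_bool_def sum.If_cases Int_def)
  have "card U * card U \<le> (\<Sum>a\<in>U. 2 * card (out_nbs U a))"
    using neg sum_bounded_below[of U "card U" "\<lambda>a. 2 * card (out_nbs U a)"] by (auto simp: not_less)
  \<comment> \<open>One copy of the sum is indexed by tails and the other by heads, so by asymmetry
    each ordered pair of distinct vertices contributes at most 1.\<close>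
  also have "\<dots> = (\<Sum>a\<in>U. \<Sum>w\<in>U. of_bool (a \<rightarrow>\<^bsub>G\<^esub> w)) + (\<Sum>a\<in>U. \<Sum>w\<in>U. of_bool (w \<rightarrow>\<^bsub>G\<^esub> a))"
    by (subst (2) sum.swap) (simp add: out sum_distrib_left mult_2 sum.distrib)
  also have "\<dots> = (\<Sum>a\<in>U. \<Sum>w\<in>U. of_bool (a \<rightarrow>\<^bsub>G\<^esub> w) + of_bool (w \<rightarrow>\<^bsub>G\<^esub> a))"
    by (simp add: sum.distrib)
  also have "\<dots> \<le> (\<Sum>a\<in>U. \<Sum>w\<in>U. of_bool (w \<noteq> a))"
    using dominates_asym adj_not_same by (intro sum_mono) (auto simp: of_bool_def)
  also have "\<dots> = (\<Sum>a\<in>U. card U - 1)"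
  proof (rule sum.cong)
    fix a assume "a \<in> U"
    moreover have "U \<inter> {w. w \<noteq> a} = U - {a}" by auto
    ultimately show "(\<Sum>w\<in>U. of_bool (w \<noteq> a)) = card U - 1"
      using fin by (simp add: of_bool_def sum.If_cases)
  qed simp
  also have "\<dots> = card U * (card U - 1)" by simp
  finally show False
    using assms(2) fin by (cases "card U") auto
qed

text \<open>In a subtournament maximising the minimum out-degree \<open>d\<close>, deleting all vertices of
  out-degree at most \<open>d + k\<close> would raise the minimum if there were at most \<open>k\<close> of them.\<close>

lemma exists_subtournament_many_low:
  assumes "verts G \<noteq> {}" "\<And>v. v \<in> verts G \<Longrightarrow> d0 \<le> out_degree G v" "k \<le> d0"
  obtains U d where "U \<subseteq> verts G" "d0 \<le> d" "\<And>u. u \<in> U \<Longrightarrow> d \<le> card (out_nbs U u)"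
    "k < card {u \<in> U. card (out_nbs U u) \<le> d + k}"
proof -
  define P where "P d \<longleftrightarrow> (\<exists>U\<subseteq>verts G. U \<noteq> {} \<and> (\<forall>u\<in>U. d \<le> card (out_nbs U u)))" for d
  have lt: "card (out_nbs U u) < card U" if "U \<subseteq> verts G" "u \<in> U" for U u
    using that adj_not_same finite_subset[OF that(1)]
    by (intro psubset_card_mono) (auto simp: out_nbs_def)
  have "P d0"
    using assms(1,2) by (auto simp: P_def card_out_nbs_verts)
  moreover have bound: "\<forall>d. P d \<longrightarrow> d \<le> card (verts G)"
  proof (intro allI impI)
    fix d assume "P d"
    then obtain U u where U: "U \<subseteq> verts G" "u \<in> U" "d \<le> card (out_nbs U u)"
      by (auto simp: P_def)
    then show "d \<le> card (verts G)"
      using lt[of U u] card_mono[OF finite_verts U(1)] by linarith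
  qed
  ultimately obtain d where d: "P d" "\<And>d'. P d' \<Longrightarrow> d' \<le> d"
    by (metis Greatest_le_nat GreatestI_nat)
  then obtain U where U: "U \<subseteq> verts G" "U \<noteq> {}" "\<And>u. u \<in> U \<Longrightarrow> d \<le> card (out_nbs U u)"
    unfolding P_def by blast
  have "d0 \<le> d" using d \<open>P d0\<close> by blast
  define L where "L = {u \<in> U. card (out_nbs U u) \<le> d + k}"
  have fin: "finite U" "finite L"
    using U(1) finite_subset[OF U(1)] by (auto simp: L_def)
  have "k < card L"
  proof (rule ccontr)
    assume "\<not> k < card L"
    \<comment> \<open>Out-degrees inside \<open>U\<close> are at least \<open>d\<close>, hence at
      least \<open>k\<close>, and less than \<open>card U\<close>. So deleting at most
      \<open>k\<close> vertices does not empty \<open>U\<close>.\<close>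
    have "k < card U"
      using U lt[OF U(1)] assms(3) \<open>d0 \<le> d\<close> by (metis ex_in_conv le_trans not_less)
    have "d + 1 \<le> card (out_nbs (U - L) u)" if "u \<in> U - L" for u
    proof -
      have "out_nbs (U - L) u = out_nbs U u - L"
        by (auto simp: out_nbs_def)
      moreover have "card (out_nbs U u) > d + k"
        using that by (auto simp: L_def)
      ultimately show ?thesis
        using diff_card_le_card_Diff[OF fin(2), of "out_nbs U u"] \<open>\<not> k < card L\<close> by simp
    qed
    moreover have "U - L \<noteq> {}"
    proof
      assume "U - L = {}"
      then have "U = L" by (auto simp: L_def)
      then show False using \<open>k < card U\<close> \<open>\<not> k < card L\<close> by simp
    qed
    ultimately have "P (d + 1)"
      using U(1) unfolding P_def by (intro exI[of _ "U - L"]) auto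
    then show False using d(2) by fastforce
  qed
  then show thesis
    using that U \<open>d0 \<le> d\<close> unfolding L_def by blast
qed

section \<open>Paths of length at most 3 avoiding a given set\<close>

lemma exists_short_path_avoiding:
  assumes U: "U \<subseteq> verts G" "\<And>u. u \<in> U \<Longrightarrow> d \<le> card (out_nbs U u)"
    and xy: "x \<in> U" "y \<in> U" "y \<rightarrow>\<^bsub>G\<^esub> x"
    and low: "card (out_nbs U x) \<le> d + k" "card (out_nbs U y) \<le> d + k"
    and W: "finite W" "x \<in> W" "y \<in> W" "2 * card W + card (midpoints U x y) + 3 * k < d"
  shows "\<exists>p. short_path x p y \<and> set (inner_verts p) \<inter> W = {}"
proof (rule ccontr)
  assume no: "\<not> ?thesis"
  have fin: "finite U"
    using finite_subset[OF U(1)] by simp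
  have ne: "x \<noteq> y" and nxy: "\<not> x \<rightarrow>\<^bsub>G\<^esub> y"
    using xy adj_not_same dominates_asym by blast+
  have irr: "\<not> v \<rightarrow>\<^bsub>G\<^esub> v" for v
    using adj_not_same by blast
  have mid: "midpoints U x y \<subseteq> W"
  proof
    fix v assume v: "v \<in> midpoints U x y"
    then have "v \<noteq> x" "v \<noteq> y" using irr by (auto simp: midpoints_def)
    then obtain p where "short_path x p y" "inner_verts p = [v]"
      using v ne short_path_of_verts[of x "[v]" y] by (auto simp: midpoints_def)
    then show "v \<in> W" using no by fastforce
  qed
  have no3: False if "a \<notin> W" "b \<notin> W" "x \<rightarrow>\<^bsub>G\<^esub> a" "a \<rightarrow>\<^bsub>G\<^esub> b" "b \<rightarrow>\<^bsub>G\<^esub> y" for a b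
  proof -
    have "distinct (x # [a, b] @ [y])" using that irr ne W by auto
    moreover have "successively (\<lambda>u v. u \<rightarrow>\<^bsub>G\<^esub> v) (x # [a, b] @ [y])" using that by simp
    ultimately obtain p where "short_path x p y" "inner_verts p = [a, b]"
      using short_path_of_verts[of x "[a, b]" y] by auto
    then show False using no that by fastforce
  qed
  define A where "A = out_nbs U x - W"
  define R where "R = {v \<in> U. v \<rightarrow>\<^bsub>G\<^esub> x \<and> y \<rightarrow>\<^bsub>G\<^esub> v}"
  let ?C = "out_nbs U x \<inter> out_nbs U y"
  \<comment> \<open>Since \<open>y\<close> dominates \<open>x\<close>, no out-neighbour of
    \<open>x\<close> equals \<open>y\<close>; each is either dominated by \<open>y\<close> or a
    midpoint.\<close>
  have split_x: "card (out_nbs U x) = card ?C + card (midpoints U x y)"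
  proof -
    have "out_nbs U x = ?C \<union> midpoints U x y"
      using dominates_total U(1) xy nxy by (force simp: out_nbs_def midpoints_def)
    moreover have "?C \<inter> midpoints U x y = {}"
      using dominates_asym by (auto simp: out_nbs_def midpoints_def)
    ultimately show ?thesis
      using fin card_Un_disjoint[of ?C "midpoints U x y"] by simp
  qed
  have split_y: "card R + card ?C \<le> card (out_nbs U y)"
  proof -
    have "R \<inter> ?C = {}" "R \<union> ?C \<subseteq> out_nbs U y"
      using dominates_asym by (auto simp: out_nbs_def R_def)
    then show ?thesis
      using fin card_Un_disjoint[of R ?C] card_mono[of "out_nbs U y" "R \<union> ?C"]
      by (simp add: R_def)
  qed
  have "A \<noteq> {}"
  proof
    assume "A = {}"
    then have "card (out_nbs U x) \<le> card W"
      using W(1) by (intro card_mono) (auto simp: A_def)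
    then show False using U(2)[OF xy(1)] W(4) by linarith
  qed
  moreover have "A \<subseteq> verts G" using U(1) by (auto simp: A_def out_nbs_def)
  ultimately obtain a where a: "a \<in> A" "2 * card (out_nbs A a) < card A"
    using exists_low_score_vertex by blast
  have "A \<subseteq> out_nbs U x - midpoints U x y"
    using mid by (auto simp: A_def)
  moreover have "midpoints U x y \<subseteq> out_nbs U x"
    by (auto simp: out_nbs_def midpoints_def)
  ultimately have cA: "card A + card (midpoints U x y) \<le> card (out_nbs U x)"
    using fin split_x card_Diff_subset[of "midpoints U x y" "out_nbs U x"]
      card_mono[of "out_nbs U x - midpoints U x y" A] by simp
  \<comment> \<open>An out-neighbour \<open>v\<close> of \<open>a\<close> outside \<open>W\<close>
    differs from \<open>x\<close> and \<open>y\<close>, which lie in \<open>W\<close>. If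
    \<open>x\<close> does not dominate it, then it dominates \<open>x\<close>, and \<open>y\<close>
    dominates it, since otherwise the path \<open>x, a, v, y\<close> would avoid
    \<open>W\<close>.\<close>
  have "out_nbs U a \<subseteq> out_nbs A a \<union> W \<union> R"
  proof
    fix v assume v: "v \<in> out_nbs U a"
    show "v \<in> out_nbs A a \<union> W \<union> R"
    proof (cases "v \<in> W \<or> x \<rightarrow>\<^bsub>G\<^esub> v")
      case True
      then show ?thesis using v by (auto simp: A_def out_nbs_def)
    next
      case False
      then have "v \<noteq> x" "v \<noteq> y" using W by auto
      moreover have "\<not> v \<rightarrow>\<^bsub>G\<^esub> y"
        using no3[of a v] a v False by (auto simp: A_def out_nbs_def)
      ultimately show ?thesis
        using False v dominates_total U(1) xy unfolding R_def out_nbs_def by blast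
    qed
  qed
  then have "card (out_nbs U a) \<le> card (out_nbs A a \<union> W \<union> R)"
    using fin W(1) by (intro card_mono) (auto simp: A_def R_def)
  also have "\<dots> \<le> card (out_nbs A a) + card W + card R"
    using card_Un_le[of "out_nbs A a \<union> W" R] card_Un_le[of "out_nbs A a" W] by linarith
  finally have "card (out_nbs U a) \<le> card (out_nbs A a) + card W + card R" .
  moreover have "d \<le> card (out_nbs U a)" "d \<le> card (out_nbs U x)"
    using U(2) a xy by (auto simp: A_def out_nbs_def)
  \<comment> \<open>Let \<open>p = card (midpoints U x y)\<close>. Then
    \<open>card A <= d + k - p\<close>, and \<open>card R <= k + p\<close> because \<open>?C\<close>
    has at least \<open>d - p\<close> elements. Doubling the estimate for \<open>a\<close> gives
    \<open>2 * d < (d + k - p) + 2 * card W + 2 * (k + p)\<close>, that is,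
    \<open>d < 2 * card W + p + 3 * k\<close>.\<close>
  ultimately show False
    using a(2) cA split_x split_y low W(4) by linarith
qed

section \<open>Pairs joined by paths of length 2, and the number of pairs\<close>

text \<open>\<open>f\<close> matches the pairs in \<open>J\<close> with midpoints of their own. When
  \<open>card J\<close> is greatest, no unmatched pair has a free midpoint left, which bounds its
  \<open>midpoints\<close> by \<open>card B + card J\<close>.\<close>

lemma exists_maximal_matching_midpoints:
  assumes "finite I" "finite B"
  obtains J f where "J \<subseteq> I" "inj_on f J" "\<And>x y. (x, y) \<in> J \<Longrightarrow> f (x, y) \<in> midpoints U x y - B"
    "\<And>x y. (x, y) \<in> I - J \<Longrightarrow> midpoints U x y \<subseteq> B \<union> f ` J"
proof -
  define M where "M Jf \<longleftrightarrow> fst Jf \<subseteq> I \<and> inj_on (snd Jf) (fst Jf) \<and>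
      (\<forall>(x, y)\<in>fst Jf. snd Jf (x, y) \<in> midpoints U x y - B)"
    for Jf :: "('a \<times> 'a) set \<times> ('a \<times> 'a \<Rightarrow> 'a)"
  \<comment> \<open>Nothing is matched yet, so any function serves.\<close>
  have "M ({}, undefined)" by (simp add: M_def)
  moreover have "\<forall>Jf. M Jf \<longrightarrow> card (fst Jf) < Suc (card I)"
    using assms by (auto simp: M_def less_Suc_eq_le intro: card_mono)
  ultimately obtain Jf where "M Jf" and max: "\<forall>Jf'. M Jf' \<longrightarrow> card (fst Jf') \<le> card (fst Jf)"
    using ex_has_greatest_nat[of M "({}, undefined)" "\<lambda>Jf. card (fst Jf)" "Suc (card I)"] by blast
  obtain J f where eq: "Jf = (J, f)" by (cases Jf)
  then have Jf: "J \<subseteq> I" "inj_on f J"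
      "\<And>x y. (x, y) \<in> J \<Longrightarrow> f (x, y) \<in> midpoints U x y - B"
    using \<open>M Jf\<close> by (auto simp: M_def)
  have "midpoints U x y \<subseteq> B \<union> f ` J" if i: "(x, y) \<in> I - J" for x y
  proof (rule ccontr)
    assume "\<not> ?thesis"
    then obtain v where v: "v \<in> midpoints U x y" "v \<notin> B" "v \<notin> f ` J" by blast
    have "inj_on (f((x, y) := v)) (insert (x, y) J)"
      using Jf(2) v(3) i by (auto simp: inj_on_def image_iff)
    then have "M (insert (x, y) J, f((x, y) := v))"
      using Jf v i by (auto simp: M_def)
    then have "card (insert (x, y) J) \<le> card J"
      using max[rule_format, of "(insert (x, y) J, f((x, y) := v))"] eq by simp
    then show False
      using i finite_subset[OF Jf(1) assms(1)] by simp
  qed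
  then show thesis using that Jf by blast
qed

text \<open>By asymmetry the set and its mirror image are disjoint, and both lie off the
  diagonal.\<close>

lemma card_arcs_within_le:
  assumes "finite B"
  shows "2 * card {(x, y) \<in> B \<times> B. y \<rightarrow>\<^bsub>G\<^esub> x} \<le> card B * (card B - 1)"
proof -
  let ?I = "{(x, y) \<in> B \<times> B. y \<rightarrow>\<^bsub>G\<^esub> x}"
  have fin: "finite ?I"
    using assms by (auto intro: finite_subset[of _ "B \<times> B"])
  have "?I \<inter> prod.swap ` ?I = {}"
    using dominates_asym by auto
  moreover have "card (prod.swap ` ?I) = card ?I"
    by (rule card_image) (auto simp: inj_on_def)
  ultimately have "2 * card ?I = card (?I \<union> prod.swap ` ?I)"
    using fin by (simp add: card_Un_disjoint)
  also have "\<dots> \<le> card (B \<times> B - Id_on B)"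
    using assms adj_not_same by (intro card_mono) (auto simp: Id_on_iff)
  also have "\<dots> = card B * card B - card B"
  proof -
    have "Id_on B = (\<lambda>x. (x, x)) ` B" by auto
    then have "card (Id_on B) = card B" by (simp add: card_image inj_on_def)
    moreover have "Id_on B \<subseteq> B \<times> B" by auto
    ultimately show ?thesis
      using assms by (simp add: card_Diff_subset card_cartesian_product finite_subset)
  qed
  finally show ?thesis by (simp add: algebra_simps)
qed

section \<open>Assembling the subdivision\<close>

lemma exists_complete_subdivision:
  assumes "verts G \<noteq> {}"
    and deg: "\<And>v. v \<in> verts G \<Longrightarrow> 2 * k\<^sup>2 + 4 * k \<le> out_degree G v"
  shows "\<exists>B P. card B = k \<and> complete_subdivision B P \<and>
           (\<forall>x\<in>B. \<forall>y\<in>B. x \<noteq> y \<longrightarrow> length (P x y) \<le> 3)"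
proof -
  obtain U d where U: "U \<subseteq> verts G" "\<And>u. u \<in> U \<Longrightarrow> d \<le> card (out_nbs U u)"
      and d: "2 * k\<^sup>2 + 4 * k \<le> d"
      and L: "k < card {u \<in> U. card (out_nbs U u) \<le> d + k}"
    by (rule exists_subtournament_many_low[OF assms, of k]) auto
  obtain B where B: "B \<subseteq> {u \<in> U. card (out_nbs U u) \<le> d + k}" "card B = k" "finite B"
    using obtain_subset_with_card_n[OF less_imp_le[OF L]] by auto
  \<comment> \<open>The pairs that need inner vertices; all other pairs of distinct branch vertices
    are joined by a single arc.\<close>
  define I where "I = {(x, y) \<in> B \<times> B. y \<rightarrow>\<^bsub>G\<^esub> x}"
  have "finite I"
    using B by (auto simp: I_def intro: finite_subset[of _ "B \<times> B"])
  have cI: "2 * card I \<le> k * (k - 1)"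
    using card_arcs_within_le[OF B(3)] B(2) by (simp add: I_def)
  have ne: "x \<in> B" "y \<in> B" "x \<noteq> y" if "(x, y) \<in> I" for x y
    using that adj_not_same by (auto simp: I_def)
  obtain J f where J: "J \<subseteq> I" "inj_on f J"
      and f: "\<And>x y. (x, y) \<in> J \<Longrightarrow> f (x, y) \<in> midpoints U x y - B"
      and rest: "\<And>x y. (x, y) \<in> I - J \<Longrightarrow> midpoints U x y \<subseteq> B \<union> f ` J"
    using exists_maximal_matching_midpoints[OF \<open>finite I\<close> B(3), of U] by metis
  have "finite J" using J \<open>finite I\<close> finite_subset by blast
  let ?W = "B \<union> f ` J" and ?inner = "\<lambda>p. set (inner_verts p)"
    and ?sp = "\<lambda>(x, y) p. short_path x p y"
  \<comment> \<open>The branch vertices, one matched vertex per pair in \<open>J\<close>, and two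
    inner vertices for each greedy pair other than the current one.\<close>
  let ?m = "k + card J + 2 * (card (I - J) - 1)"
  have cW: "finite ?W" "card ?W \<le> k + card J"
    using B \<open>finite J\<close> card_Un_le[of B "f ` J"] J(2) by (auto simp: card_image)
  have "\<exists>Q. (\<forall>i\<in>I - J. ?sp i (Q i) \<and> ?inner (Q i) \<inter> ?W = {}) \<and>
      disjoint_family_on (\<lambda>i. ?inner (Q i)) (I - J)"
  proof (rule greedy_disjoint_family[where m = ?m and c = 2])
    fix i X assume i: "i \<in> I - J" and X: "finite X" "?W \<subseteq> X" "card X \<le> ?m"
    obtain x y where xy: "i = (x, y)" by (cases i)
    have "card (midpoints U x y) \<le> k + card J"
      using rest[of x y] i xy cW card_mono[OF cW(1)] by (meson le_trans)
    moreover have "card (I - J) = card I - card J" "card J < card I"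
      using i J \<open>finite I\<close> card_Diff_subset[of J I] psubset_card_mono[of I J] \<open>finite J\<close> by auto
    moreover have "2 * k\<^sup>2 = 2 * (k * (k - 1)) + 2 * k"
      by (cases k) (simp_all add: power2_eq_square)
    \<comment> \<open>With \<open>n = card I\<close> and \<open>t = card J\<close> the left side is
      at most \<open>2 * (k + t + 2 * (n - t - 1)) + (k + t) + 3 * k = 4 * n + 6 * k - t -
      4\<close>. As \<open>4 * n <= 2 * k * (k - 1)\<close>, this is below
      \<open>2 * k^2 + 4 * k\<close>.\<close>
    ultimately have "2 * card X + card (midpoints U x y) + 3 * k < d"
      using X(3) cI d by linarith
    then obtain p where "short_path x p y" "?inner p \<inter> X = {}"
      using exists_short_path_avoiding[OF U, of x y k X] X B i xy by (auto simp: I_def)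
    then show "\<exists>p. ?sp i p \<and> ?inner p \<inter> X = {} \<and> card (?inner p) \<le> 2"
      using xy card_inner_verts_short_path by auto
  qed (use cW \<open>finite I\<close> in auto)
  then obtain Q where Q: "\<And>x y. (x, y) \<in> I - J \<Longrightarrow> short_path x (Q (x, y)) y"
      "\<And>i. i \<in> I - J \<Longrightarrow> ?inner (Q i) \<inter> ?W = {}"
      "disjoint_family_on (\<lambda>i. ?inner (Q i)) (I - J)"
    by fastforce
  have "\<exists>p. short_path x p y \<and> inner_verts p = [f (x, y)]" if "(x, y) \<in> J" for x y
    using that f[OF that] ne[of x y] J(1) by (intro short_path_of_verts) (auto simp: midpoints_def)
  then obtain F where F: "\<And>x y. (x, y) \<in> J \<Longrightarrow>
      short_path x (F x y) y \<and> inner_verts (F x y) = [f (x, y)]"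
    by metis
  have "\<exists>p. short_path x p y \<and> inner_verts p = []" if "x \<in> B" "y \<in> B" "x \<noteq> y" "(x, y) \<notin> I" for x y
    using that dominates_total[of x y] U(1) B(1)
    by (intro short_path_of_verts) (auto simp: I_def)
  then obtain D where D: "\<And>x y. x \<in> B \<Longrightarrow> y \<in> B \<Longrightarrow> x \<noteq> y \<Longrightarrow> (x, y) \<notin> I \<Longrightarrow>
      short_path x (D x y) y \<and> inner_verts (D x y) = []"
    by metis
  define P where "P x y = (if (x, y) \<in> J then F x y else if (x, y) \<in> I then Q (x, y) else D x y)" for x y
  have sp: "short_path x (P x y) y" if "x \<in> B" "y \<in> B" "x \<noteq> y" for x y
    using that F D Q(1) by (auto simp: P_def)
  have inner: "?inner (P x y) =
      (if (x, y) \<in> J then {f (x, y)} else if (x, y) \<in> I then ?inner (Q (x, y)) else {})"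
    if "x \<in> B" "y \<in> B" "x \<noteq> y" for x y
    using that F D by (auto simp: P_def)
  have "?inner (P x y) \<inter> B = {}" if "x \<in> B" "y \<in> B" "x \<noteq> y" for x y
    using that f Q(2)[of "(x, y)"] by (auto simp: inner)
  moreover have "?inner (P x y) \<inter> ?inner (P x' y') = {}"
    if "x \<in> B" "y \<in> B" "x \<noteq> y" "x' \<in> B" "y' \<in> B" "x' \<noteq> y'" "(x, y) \<noteq> (x', y')" for x y x' y'
  proof -
    \<comment> \<open>The greedy paths avoid \<open>?W\<close>, which contains every matched
      midpoint.\<close>
    have QJ: "?inner (Q i) \<inter> {f j} = {}" if "i \<in> I" "i \<notin> J" "j \<in> J" for i j
      using Q(2)[of i] that by blast
    have JJ: "f i \<noteq> f j" if "i \<in> J" "j \<in> J" "i \<noteq> j" for i j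
      using J(2) that by (auto dest: inj_onD)
    have QQ: "?inner (Q i) \<inter> ?inner (Q j) = {}"
      if "i \<in> I" "i \<notin> J" "j \<in> I" "j \<notin> J" "i \<noteq> j" for i j
      using Q(3) that by (auto simp: disjoint_family_on_def)
    show ?thesis
      unfolding inner[OF that(1-3)] inner[OF that(4-6)]
      using QJ[of "(x, y)" "(x', y')"] QJ[of "(x', y')" "(x, y)"] JJ[of "(x, y)" "(x', y')"]
        QQ[of "(x, y)" "(x', y')"] that(7)
      by (cases "(x, y) \<in> J"; cases "(x', y') \<in> J"; cases "(x, y) \<in> I"; cases "(x', y') \<in> I") simp_all
  qed
  ultimately have "complete_subdivision B P"
    using sp B(1) U(1) by (auto simp: complete_subdivision_def short_path_def)
  then show ?thesis
    using sp B(2) by (auto simp: short_path_def)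
qed

end

theorem theorem2p4:
  fixes T :: "('a, 'b) pre_digraph" and k :: nat
  assumes "k \<ge> 2"
    and "tournament T"
    and "verts T \<noteq> {}"
    and "real (min_out_degree T) \<ge> 2 * real k ^ 2 + 147 * real k powr (7 / 4)"
  shows "\<exists>B P. card B = k \<and> pre_digraph.complete_subdivision T B P \<and>
           (\<forall>x\<in>B. \<forall>y\<in>B. x \<noteq> y \<longrightarrow> length (P x y) \<le> 3)"
proof -
  interpret tournament T by fact
  \<comment> \<open>The error term of the degree hypothesis covers \<open>4 * k\<close>, because
    \<open>k\<close> is at least 1.\<close>
  have "real k powr 1 \<le> real k powr (7 / 4)"
    using assms(1) by (intro powr_mono) auto
  then have "4 * real k \<le> 147 * real k powr (7 / 4)"
    using assms(1) by simp
  then have "real (2 * k\<^sup>2 + 4 * k) \<le> real (min_out_degree T)"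
    using assms(4) by simp
  then have "2 * k\<^sup>2 + 4 * k \<le> min_out_degree T"
    by linarith
  moreover have "min_out_degree T \<le> out_degree T v" if "v \<in> verts T" for v
    using that by (simp add: min_out_degree_def)
  ultimately show ?thesis
    using exists_complete_subdivision[OF assms(3)] le_trans by blast
qed

end
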